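(* Let $\mathcal F$ be a hypergraph whose edges are colored with $k$ colors $1,\dots,k$, and let $g:V(\mathcal F)\to\mathbb N$ be a simple function. Then there exists a simple $g$-detachment $\mathcal G$ of $\mathcal F$ (possibly with multiple edges), with amalgamation function $\Psi:V(\mathcal G)\to V(\mathcal F)$ whose number function is $g$, such that: (A1) $d_{\mathcal G}(v)\approx d_{\mathcal F}(u)/g(u)$ for each $u\in V(\mathcal F)$ and each $v\in\Psi^{-1}(u)$; (A2) $d_{\mathcal G(j)}(v)\approx d_{\mathcal F(j)}(u)/g(u)$ for each $u\in V(\mathcal F)$, each $v\in\Psi^{-1}(u)$ and each $1\le j\le k$; (A3) $m_{\mathcal G}(U_1,\dots,U_r)\approx m_{\mathcal F}(u_1^{m_1},\dots,u_r^{m_r})/\prod_{i=1}^r\binom{g(u_i)}{m_i}$ for all distinct $u_1,\dots,u_r\in V(\mathcal F)$ and all $U_i\subset\Psi^{-1}(u_i)$ with $|U_i|=m_i\le g(u_i)$, $1\le i\le r$; (A4) $m_{\mathcal G(j)}(U_1,\dots,U_r)\approx m_{\mathcal F(j)}(u_1^{m_1},\dots,u_r^{m_r})/\prod_{i=1}^r\binom{g(u_i)}{m_i}$ for all distinct $u_1,\dots,u_r\in V(\mathcal F)$, all $U_i\subset\Psi^{-1}(u_i)$ with $|U_i|=m_i\le g(u_i)$, $1\le i\le r$, and each $1\le j\le k$. (Here the edges of $\mathcal G$ are those of $\mathcal F$ and carry the same colors.)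
   Context: For real $x,y$, $x\approx y$ means $\lfloor y\rfloor\le x\le\lceil y\rceil$. A hypergraph $\mathcal G$ is a quintuple $(V,E,H,\psi,\phi)$ of disjoint finite sets $V$ (vertices), $E$ (edges), $H$ (hinges), a function $\psi:H\to V$ and a surjection $\phi:H\to E$; hinge $h$ attaches edge $\phi(h)$ to vertex $\psi(h)$. $H(v)=\psi^{-1}(v)$, the degree is $d(v)=|H(v)|$, and $H(v,e)=\psi^{-1}(v)\cap\phi^{-1}(e)$. For a multiset $U$ of vertices with multiplicity function $\mu_U$, $E(U)$ is the set of edges $e$ with $|H(v,e)|=\mu_U(v)$ for every vertex $v$, and the multiplicity $m(U)=|E(U)|$. Notation: $m(u_1^{m_1},\dots,u_r^{m_r})$ is $m$ of the multiset containing $u_i$ with multiplicity $m_i$; $m(U_1,\dots,U_r)$ is $m$ of the multiset union of the sets $U_1,\dots,U_r$. A $k$-edge-coloring is a map $f:E\to\{1,\dots,k\}$, and $\mathcal G(j)$ is the sub-hypergraph formed by the edges of color $j$ (with their hinges); subscripts indicate the hypergraph in which notation is interpreted. If $\mathcal F=(V,E,H,\psi,\phi)$ and $\Psi:V\to W$ is onto, then $(W,E,H,\Psi\circ\psi,\phi)$ is an amalgamation of $\mathcal F$ and $\mathcal F$ is a detachment of it; the number function is $g(w)=|\Psi^{-1}(w)|$, and $\mathcal F$ is then called a $g$-detachment. (In the theorem the roles are: $\mathcal F$ is the amalgamation of $\mathcal G$ via $\Psi$.) A function $g:V(\mathcal G)\to\mathbb N$ is simple if $|H(v,e)|\le g(v)$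 for all vertices $v$ and edges $e$; a hypergraph is simple if the constant function $1$ is simple. *)

theory Defs
  imports Complex_Main "HOL-Library.Multiset"
begin

definition approx :: "real \<Rightarrow> real \<Rightarrow> bool"  (infix "\<approx>" 50)
  where "x \<approx> y \<longleftrightarrow> of_int \<lfloor>y\<rfloor> \<le> x \<and> x \<le> of_int \<lceil>y\<rceil>"

text \<open>
  Vertices, edges and hinges have separate types, which makes the three sets disjoint.
  The functions are total in HOL; only their values on \<open>hinges\<close> are meaningful.
\<close>

record ('v, 'e, 'h) hgraph =
  verts :: "'v set"
  edges :: "'e set"
  hinges :: "'h set"
  vert_of :: "'h \<Rightarrow> 'v"
  edge_of :: "'h \<Rightarrow> 'e"

definition hypergraph :: "('v, 'e, 'h) hgraph \<Rightarrow> bool" where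
  "hypergraph G \<longleftrightarrow>
     finite (verts G) \<and> finite (edges G) \<and> finite (hinges G) \<and>
     vert_of G ` hinges G \<subseteq> verts G \<and> edge_of G ` hinges G = edges G"

definition hinges_at :: "('v, 'e, 'h) hgraph \<Rightarrow> 'v \<Rightarrow> 'h set" where
  "hinges_at G v = {h \<in> hinges G. vert_of G h = v}"

definition degree :: "('v, 'e, 'h) hgraph \<Rightarrow> 'v \<Rightarrow> nat" where
  "degree G v = card (hinges_at G v)"

definition hinges_between :: "('v, 'e, 'h) hgraph \<Rightarrow> 'v \<Rightarrow> 'e \<Rightarrow> 'h set" where
  "hinges_between G v e = {h \<in> hinges G. vert_of G h = v \<and> edge_of G h = e}"

definition edges_on :: "('v, 'e, 'h) hgraph \<Rightarrow> 'v multiset \<Rightarrow> 'e set" where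
  "edges_on G U = {e \<in> edges G. \<forall>v\<in>verts G. card (hinges_between G v e) = count U v}"

definition multiplicity :: "('v, 'e, 'h) hgraph \<Rightarrow> 'v multiset \<Rightarrow> nat" where
  "multiplicity G U = card (edges_on G U)"

definition edge_coloring :: "nat \<Rightarrow> ('v, 'e, 'h) hgraph \<Rightarrow> ('e \<Rightarrow> nat) \<Rightarrow> bool" where
  "edge_coloring k G f \<longleftrightarrow> f ` edges G \<subseteq> {1..k}"

text \<open>The subhypergraph of the edges of color \<open>j\<close> keeps all vertices.\<close>

definition color_class ::
    "('v, 'e, 'h) hgraph \<Rightarrow> ('e \<Rightarrow> nat) \<Rightarrow> nat \<Rightarrow> ('v, 'e, 'h) hgraph" where
  "color_class G f j =
     \<lparr>verts = verts G,
      edges = {e \<in> edges G. f e = j},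
      hinges = {h \<in> hinges G. f (edge_of G h) = j},
      vert_of = vert_of G,
      edge_of = edge_of G\<rparr>"

definition simple_fun :: "('v, 'e, 'h) hgraph \<Rightarrow> ('v \<Rightarrow> nat) \<Rightarrow> bool" where
  "simple_fun G g \<longleftrightarrow> (\<forall>v\<in>verts G. \<forall>e\<in>edges G. card (hinges_between G v e) \<le> g v)"

definition simple_hypergraph :: "('v, 'e, 'h) hgraph \<Rightarrow> bool" where
  "simple_hypergraph G \<longleftrightarrow> simple_fun G (\<lambda>_. 1)"

text \<open>
  \<open>amalgamation F G \<Psi>\<close>: \<open>F\<close> is the amalgamation of \<open>G\<close> via \<open>\<Psi>\<close>. Equality of the incidence
  functions is required on the hinges only.
\<close>

definition amalgamation ::
    "('w, 'e, 'h) hgraph \<Rightarrow> ('v, 'e, 'h) hgraph \<Rightarrow> ('v \<Rightarrow> 'w) \<Rightarrow> bool" where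
  "amalgamation F G \<Psi> \<longleftrightarrow>
     \<Psi> ` verts G = verts F \<and> edges F = edges G \<and> hinges F = hinges G \<and>
     (\<forall>h\<in>hinges G. vert_of F h = \<Psi> (vert_of G h) \<and> edge_of F h = edge_of G h)"

definition fiber :: "('v, 'e, 'h) hgraph \<Rightarrow> ('v \<Rightarrow> 'w) \<Rightarrow> 'w \<Rightarrow> 'v set" where
  "fiber G \<Psi> w = {v \<in> verts G. \<Psi> v = w}"

definition detachment ::
    "('v, 'e, 'h) hgraph \<Rightarrow> ('w, 'e, 'h) hgraph \<Rightarrow> ('v \<Rightarrow> 'w) \<Rightarrow> ('w \<Rightarrow> nat) \<Rightarrow> bool" where
  "detachment G F \<Psi> g \<longleftrightarrow>
     hypergraph G \<and> amalgamation F G \<Psi> \<and> (\<forall>w\<in>verts F. g w = card (fiber G \<Psi> w))"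

end

theory Submission
  imports Defs
begin

text \<open>
  Split off one vertex at a time. Which edges meet the new vertex is decided by rounding: an edge
  with \<open>m\<close> hinges at a vertex that still has to be split into \<open>c\<close> vertices gets weight \<open>m / c\<close>,
  and a set of edges is chosen whose size within every color, within every edge type (the
  multiplicities at all vertices), within every color and type, and in total is the sum of the
  weights rounded up or down. Arranging the weights in a matrix indexed by colors and types, this
  is the rounding of a real matrix together with its row sums, column sums and total. Edges of
  weight 0 and 1 are decided by the rounding, which makes the detachment simple. The estimates
  compose, because a rounded value of \<open>x / n\<close>, where \<open>x\<close> is a rounded value of \<open>y\<close>, is a rounded
  value of \<open>y / n\<close>; the binomial coefficients arise from
  \<open>(m / c) / ((c - 1) choose (m - 1)) = 1 / (c choose m)\<close> and
  \<open>((c - m) / c) / ((c - 1) choose m) = 1 / (c choose m)\<close>.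
\<close>

section \<open>Rounding matrices\<close>

text \<open>Gaussian elimination: an equation with a nonzero coefficient on \<open>K\<close> is
  solved for one unknown \<open>k0\<close>, which removes one equation and one unknown; an equation
  that is zero on \<open>K\<close> is simply dropped.\<close>

lemma nontrivial_solution_exists:
  fixes a :: "'i \<Rightarrow> 'k \<Rightarrow> real"
  assumes "finite I" "finite K" "card I < card K"
  shows "\<exists>z. (\<exists>k\<in>K. z k \<noteq> 0) \<and> (\<forall>i\<in>I. (\<Sum>k\<in>K. a i k * z k) = 0)"
  using assms
proof (induction I arbitrary: K a rule: finite_induct)
  case empty
  then obtain k where "k \<in> K"
    by (metis card.empty card_gt_0_iff ex_in_conv)
  then show ?case
    by (intro exI[of _ "\<lambda>_. 1"]) auto
next
  case (insert i I)
  show ?case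
  proof (cases "\<forall>k\<in>K. a i k = 0")
    case True
    have "card I < card K"
      using insert by simp
    from insert.IH[OF insert.prems(1) this, of a] True show ?thesis
      by force
  next
    case False
    then obtain k0 where k0: "k0 \<in> K" "a i k0 \<noteq> 0"
      by blast
    define K' where "K' = K - {k0}"
    \<comment> \<open>The other rows after elimination with pivot \<open>a i k0\<close>. The
      eliminated unknown is restored in \<open>z'\<close> from equation \<open>i\<close>.\<close>
    define a' where "a' = (\<lambda>j k. a j k - a j k0 * a i k / a i k0)"
    have "finite K'" "card I < card K'"
      using insert k0 by (auto simp: K'_def)
    from insert.IH[OF this, of a'] obtain z
      where z: "\<exists>k\<in>K'. z k \<noteq> 0" "\<forall>j\<in>I. (\<Sum>k\<in>K'. a' j k * z k) = 0"
      by blast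
    define s where "s = (\<Sum>k\<in>K'. a i k * z k)"
    define z' where "z' = z(k0 := - s / a i k0)"
    have split: "(\<Sum>k\<in>K. a j k * z' k) = (\<Sum>k\<in>K'. a j k * z k) - a j k0 * s / a i k0" for j
    proof -
      have "(\<Sum>k\<in>K. a j k * z' k) = a j k0 * z' k0 + (\<Sum>k\<in>K'. a j k * z' k)"
        using insert.prems(1) k0(1) by (simp add: K'_def sum.remove)
      also have "(\<Sum>k\<in>K'. a j k * z' k) = (\<Sum>k\<in>K'. a j k * z k)"
        by (intro sum.cong) (auto simp: z'_def K'_def)
      finally show ?thesis
        by (simp add: z'_def)
    qed
    have "(\<Sum>k\<in>K. a j k * z' k) = 0" if "j \<in> I" for j
    proof -
      have "(\<Sum>k\<in>K'. a' j k * z k) = (\<Sum>k\<in>K'. a j k * z k) - a j k0 * s / a i k0"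
        by (simp add: a'_def s_def sum_subtractf algebra_simps sum_distrib_left sum_divide_distrib)
      then show ?thesis
        using z(2) that split by simp
    qed
    moreover have "(\<Sum>k\<in>K. a i k * z' k) = 0"
      using split[of i] k0 by (simp add: s_def)
    moreover have "\<exists>k\<in>K. z' k \<noteq> 0"
      using z(1) by (auto simp: z'_def K'_def)
    ultimately show ?thesis
      by blast
  qed
qed

text \<open>The fibers of \<open>p\<close> partition \<open>K\<close> and each has at least two
  elements. Applied to \<open>fst\<close> and \<open>snd\<close>, this bounds the vertices on either
  side of a leafless bipartite graph by half the number of edges.\<close>

lemma card_image_twice_le:
  assumes "finite K" and "\<And>k. k \<in> K \<Longrightarrow> \<exists>k'\<in>K. k' \<noteq> k \<and> p k' = p k"
  shows "2 * card (p ` K) \<le> card K"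
proof -
  have "2 * card (p ` K) = (\<Sum>i\<in>p ` K. 2)"
    by simp
  also have "\<dots> \<le> (\<Sum>i\<in>p ` K. card {k \<in> K. p k = i})"
  proof (rule sum_mono)
    fix i assume "i \<in> p ` K"
    then obtain k k' where "{k, k'} \<subseteq> {k \<in> K. p k = i}" "k \<noteq> k'"
      using assms(2) by fastforce
    then show "2 \<le> card {k \<in> K. p k = i}"
      using card_mono[of "{k \<in> K. p k = i}" "{k, k'}"] assms(1) by simp
  qed
  also have "\<dots> = card K"
    using sum.group[of K "p ` K" p "\<lambda>_. 1 :: nat"] assms(1) by simp
  finally show ?thesis .
qed

text \<open>A nonempty bipartite graph without leaves has at least as many edges as vertices, and its
  vertex conditions are linearly dependent, so a dimension count replaces the search for a cycle.\<close>

lemma circulation_exists: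
  fixes K :: "('a \<times> 'b) set"
  assumes "finite K" "K \<noteq> {}"
    and row: "\<And>k. k \<in> K \<Longrightarrow> \<exists>k'\<in>K. k' \<noteq> k \<and> fst k' = fst k"
    and col: "\<And>k. k \<in> K \<Longrightarrow> \<exists>k'\<in>K. k' \<noteq> k \<and> snd k' = snd k"
  shows "\<exists>z :: 'a \<times> 'b \<Rightarrow> real. (\<exists>k\<in>K. z k \<noteq> 0) \<and>
    (\<forall>i. (\<Sum>k | k \<in> K \<and> fst k = i. z k) = 0) \<and> (\<forall>j. (\<Sum>k | k \<in> K \<and> snd k = j. z k) = 0)"
proof -
  obtain k0 where k0: "k0 \<in> K"
    using assms by blast
  \<comment> \<open>The equation of column \<open>j0\<close> is left out, so that there are strictly
    fewer equations than unknowns. It follows from the others, because all rows and all columns have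
    the same total.\<close>
  define j0 where "j0 = snd k0"
  define I where "I = Inl ` fst ` K \<union> Inr ` (snd ` K - {j0})"
  define a :: "'a + 'b \<Rightarrow> 'a \<times> 'b \<Rightarrow> real" where
    "a = (\<lambda>c k. case c of Inl i \<Rightarrow> of_bool (fst k = i) | Inr j \<Rightarrow> of_bool (snd k = j))"
  have "finite I"
    using assms by (simp add: I_def)
  have "card I = card (fst ` K) + card (snd ` K - {j0})"
    unfolding I_def using assms(1)
    by (subst card_Un_disjoint) (auto simp: card_image)
  moreover have "card (snd ` K - {j0}) < card (snd ` K)"
    using k0 assms(1) by (intro psubset_card_mono) (auto simp: j0_def)
  ultimately have "card I < card K"
    using card_image_twice_le[OF assms(1) row] card_image_twice_le[OF assms(1) col] by linarith
  from nontrivial_solution_exists[OF \<open>finite I\<close> assms(1) this, of a] obtain z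
    where z: "\<exists>k\<in>K. z k \<noteq> 0" "\<And>c. c \<in> I \<Longrightarrow> (\<Sum>k\<in>K. a c k * z k) = 0"
    by blast
  have filt: "(\<Sum>k | k \<in> K \<and> P k. z k) = (\<Sum>k\<in>K. of_bool (P k) * z k)" for P
    using assms(1) by (simp add: sum.If_cases Int_def of_bool_def if_distrib[of "\<lambda>x. x * _"] cong: if_cong)
  have rows: "(\<Sum>k | k \<in> K \<and> fst k = i. z k) = 0" for i
  proof (cases "i \<in> fst ` K")
    case True
    then show ?thesis
      using z(2)[of "Inl i"] by (simp add: I_def a_def filt)
  next
    case False
    then have "{k. k \<in> K \<and> fst k = i} = {}"
      by blast
    then show ?thesis
      by (simp only: sum.empty)
  qed
  have cols: "(\<Sum>k | k \<in> K \<and> snd k = j. z k) = 0" if "j \<noteq> j0" for j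
  proof (cases "j \<in> snd ` K")
    case True
    then show ?thesis
      using z(2)[of "Inr j"] that by (simp add: I_def a_def filt)
  next
    case False
    then have "{k. k \<in> K \<and> snd k = j} = {}"
      by blast
    then show ?thesis
      by (simp only: sum.empty)
  qed
  have "sum z K = (\<Sum>i\<in>fst ` K. \<Sum>k | k \<in> K \<and> fst k = i. z k)"
    using sum.group[of K "fst ` K" fst z] assms(1) by simp
  then have "sum z K = 0"
    using rows by simp
  moreover have "sum z K = (\<Sum>j\<in>snd ` K. \<Sum>k | k \<in> K \<and> snd k = j. z k)"
    using sum.group[of K "snd ` K" snd z] assms(1) by simp
  moreover have "\<dots> = (\<Sum>j\<in>{j0}. \<Sum>k | k \<in> K \<and> snd k = j. z k)"
    using assms(1) k0 cols by (intro sum.mono_neutral_right) (auto simp: j0_def)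
  ultimately have "(\<Sum>k | k \<in> K \<and> snd k = j0. z k) = 0"
    by simp
  then have "(\<Sum>k | k \<in> K \<and> snd k = j. z k) = 0" for j
    using cols by (cases "j = j0") simp_all
  with rows z(1) show ?thesis
    by blast
qed

section \<open>Rounding with preserved row and column sums\<close>

text \<open>Connects the row sums of a matrix that vanishes outside \<open>K\<close> with sums over
  \<open>K\<close>, the form in which \<open>circulation_exists\<close> delivers its
  equations.\<close>

lemma sum_row_support:
  assumes "finite A" "finite B" "i \<in> A" "K \<subseteq> A \<times> B" "\<And>k. k \<notin> K \<Longrightarrow> z k = (0::real)"
  shows "(\<Sum>j\<in>B. z (i, j)) = (\<Sum>k | k \<in> K \<and> fst k = i. z k)"
proof -
  have "(\<Sum>j\<in>B. z (i, j)) = (\<Sum>k\<in>Pair i ` B. z k)"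
    by (subst sum.reindex) (auto simp: inj_on_def)
  also have "\<dots> = (\<Sum>k | k \<in> K \<and> fst k = i. z k)"
  proof (rule sum.mono_neutral_right)
    show "{k. k \<in> K \<and> fst k = i} \<subseteq> Pair i ` B"
      using assms(4) by auto
  qed (use assms in auto)
  finally show ?thesis .
qed

lemma sum_col_support:
  assumes "finite A" "finite B" "j \<in> B" "K \<subseteq> A \<times> B" "\<And>k. k \<notin> K \<Longrightarrow> z k = (0::real)"
  shows "(\<Sum>i\<in>A. z (i, j)) = (\<Sum>k | k \<in> K \<and> snd k = j. z k)"
proof -
  have "(\<Sum>i\<in>A. z (i, j)) = (\<Sum>k\<in>(\<lambda>i. (i, j)) ` A. z k)"
    by (subst sum.reindex) (auto simp: inj_on_def)
  also have "\<dots> = (\<Sum>k | k \<in> K \<and> snd k = j. z k)"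
  proof (rule sum.mono_neutral_right)
    show "{k. k \<in> K \<and> snd k = j} \<subseteq> (\<lambda>i. (i, j)) ` A"
      using assms(4) by auto
  qed (use assms in auto)
  finally show ?thesis .
qed

text \<open>Were all other entries integers, \<open>x j\<close> would be minus their integral sum.
  Hence the non-integral positions of a matrix with vanishing row and column sums form a bipartite
  graph without leaves.\<close>

lemma zero_sum_other_nonint:
  fixes x :: "'a \<Rightarrow> real"
  assumes "finite B" "sum x B = 0" "j \<in> B" "x j \<notin> \<int>"
  shows "\<exists>j'\<in>B. j' \<noteq> j \<and> x j' \<notin> \<int>"
proof (rule ccontr)
  assume *: "\<not> ?thesis"
  have "x j = - sum x (B - {j})"
    using assms sum.remove[of B j x] by simp
  also have "\<dots> \<in> \<int>"
    using * by (intro Ints_minus Ints_sum) auto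
  finally show False
    using assms by simp
qed

text \<open>Induction on the number of non-integral entries. A nonzero circulation on these
  positions is added with the largest nonnegative multiple that keeps every entry between its floor
  and ceiling; the sums stay 0 and a further entry becomes integral.\<close>

lemma round_zero_sum_matrix:
  fixes x :: "'a \<times> 'b \<Rightarrow> real"
  assumes "finite A" "finite B"
    and "\<And>i. i \<in> A \<Longrightarrow> (\<Sum>j\<in>B. x (i, j)) = 0" "\<And>j. j \<in> B \<Longrightarrow> (\<Sum>i\<in>A. x (i, j)) = 0"
  shows "\<exists>y :: 'a \<times> 'b \<Rightarrow> real. (\<forall>k\<in>A \<times> B. y k \<in> \<int> \<and> y k \<approx> x k) \<and>
    (\<forall>i\<in>A. (\<Sum>j\<in>B. y (i, j)) = 0) \<and> (\<forall>j\<in>B. (\<Sum>i\<in>A. y (i, j)) = 0)"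
  using assms(3,4)
proof (induction "card {k \<in> A \<times> B. x k \<notin> \<int>}" arbitrary: x rule: less_induct)
  case (less x)
  define K where "K = {k \<in> A \<times> B. x k \<notin> \<int>}"
  have KAB: "K \<subseteq> A \<times> B" and fin: "finite K"
    using assms by (auto simp: K_def)
  show ?case
  proof (cases "K = {}")
    case True
    then show ?thesis
      using less.prems by (intro exI[of _ x]) (auto simp: K_def approx_def)
  next
    case False
    have row: "\<exists>k'\<in>K. k' \<noteq> k \<and> fst k' = fst k" if "k \<in> K" for k
      using that zero_sum_other_nonint[OF assms(2) less.prems(1), of "fst k" "snd k"]
      by (fastforce simp: K_def)
    have col: "\<exists>k'\<in>K. k' \<noteq> k \<and> snd k' = snd k" if "k \<in> K" for k
      using that zero_sum_other_nonint[OF assms(1) less.prems(2), of "snd k" "fst k"]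
      by (fastforce simp: K_def)
    obtain z0 :: "'a \<times> 'b \<Rightarrow> real" where z0: "\<exists>k\<in>K. z0 k \<noteq> 0"
      "\<And>i. (\<Sum>k | k \<in> K \<and> fst k = i. z0 k) = 0" "\<And>j. (\<Sum>k | k \<in> K \<and> snd k = j. z0 k) = 0"
      using circulation_exists[OF fin False row col] by blast
    define z where "z = (\<lambda>k. if k \<in> K then z0 k else 0)"
    have zK: "(\<Sum>k | k \<in> K \<and> P k. z k) = (\<Sum>k | k \<in> K \<and> P k. z0 k)" for P
      by (intro sum.cong) (auto simp: z_def)
    have zrow: "(\<Sum>j\<in>B. z (i, j)) = 0" if "i \<in> A" for i
      using sum_row_support[OF assms(1,2) that KAB, of z] z0(2) by (simp add: zK) (simp add: z_def)
    have zcol: "(\<Sum>i\<in>A. z (i, j)) = 0" if "j \<in> B" for j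
      using sum_col_support[OF assms(1,2) that KAB, of z] z0(3) by (simp add: zK) (simp add: z_def)
    define S where "S = {k \<in> K. z k \<noteq> 0}"
    have S: "finite S" "S \<noteq> {}" "S \<subseteq> K"
      using fin z0(1) by (auto simp: S_def z_def)
    \<comment> \<open>For \<open>k\<close> in \<open>S\<close>, \<open>t k\<close> is the multiple
      of \<open>z\<close> at which entry \<open>k\<close> reaches its ceiling (for positive
      \<open>z k\<close>) or its floor (for negative \<open>z k\<close>). An entry where the minimum
      is attained becomes integral.\<close>
    define t where
      "t = (\<lambda>k. if z k > 0 then (of_int \<lceil>x k\<rceil> - x k) / z k else (x k - of_int \<lfloor>x k\<rfloor>) / - z k)"
    define \<epsilon> where "\<epsilon> = Min (t ` S)"
    have "t k \<ge> 0" if "k \<in> S" for k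
      using that by (auto simp: t_def S_def intro!: divide_nonneg_pos divide_nonneg_neg)
    then have "\<epsilon> \<ge> 0"
      using S by (simp add: \<epsilon>_def)
    have "\<epsilon> \<in> t ` S"
      unfolding \<epsilon>_def using S by (intro Min_in) auto
    then obtain k1 where k1: "k1 \<in> S" "\<epsilon> = t k1"
      by blast
    have \<epsilon>_le: "\<epsilon> \<le> t k" if "k \<in> S" for k
      using that S by (simp add: \<epsilon>_def)
    define x' where "x' = (\<lambda>k. x k + \<epsilon> * z k)"
    have unchanged: "x' k = x k" if "k \<notin> S" for k
      using that by (auto simp: x'_def S_def z_def)
    have approx: "of_int \<lfloor>x k\<rfloor> \<le> x' k \<and> x' k \<le> of_int \<lceil>x k\<rceil>" for k
    proof (cases "k \<in> S")
      case False
      then show ?thesis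
        by (simp add: unchanged)
    next
      case True
      show ?thesis
      proof (cases "z k > 0")
        case pos: True
        then have "\<epsilon> * z k \<le> of_int \<lceil>x k\<rceil> - x k"
          using \<epsilon>_le[OF True] by (simp add: t_def pos_le_divide_eq)
        moreover have "0 \<le> \<epsilon> * z k"
          using pos \<open>\<epsilon> \<ge> 0\<close> by simp
        ultimately show ?thesis
          unfolding x'_def by linarith
      next
        case False
        then have neg: "z k < 0"
          using True by (simp add: S_def)
        then have "\<epsilon> * - z k \<le> x k - of_int \<lfloor>x k\<rfloor>"
          using \<epsilon>_le[OF True] False by (simp add: t_def pos_le_divide_eq field_simps)
        moreover have "0 \<le> \<epsilon> * - z k"
          using neg \<open>\<epsilon> \<ge> 0\<close> by (intro mult_nonneg_nonneg) auto
        ultimately show ?thesis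
          unfolding x'_def by simp linarith
      qed
    qed
    have k1_int: "x' k1 \<in> \<int>"
      using k1 by (auto simp: x'_def t_def S_def)
    have "{k \<in> A \<times> B. x' k \<notin> \<int>} \<subset> {k \<in> A \<times> B. x k \<notin> \<int>}"
    proof
      show "{k \<in> A \<times> B. x' k \<notin> \<int>} \<subseteq> {k \<in> A \<times> B. x k \<notin> \<int>}"
        using unchanged S(3) by (fastforce simp: K_def)
      show "{k \<in> A \<times> B. x' k \<notin> \<int>} \<noteq> {k \<in> A \<times> B. x k \<notin> \<int>}"
        using k1_int k1(1) S(3) by (auto simp: K_def)
    qed
    then have "card {k \<in> A \<times> B. x' k \<notin> \<int>} < card {k \<in> A \<times> B. x k \<notin> \<int>}"
      using assms by (intro psubset_card_mono) auto
    moreover have "(\<Sum>j\<in>B. x' (i, j)) = 0" if "i \<in> A" for i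
      using less.prems(1)[OF that] zrow[OF that]
      by (simp add: x'_def sum.distrib flip: sum_distrib_left)
    moreover have "(\<Sum>i\<in>A. x' (i, j)) = 0" if "j \<in> B" for j
      using less.prems(2)[OF that] zcol[OF that]
      by (simp add: x'_def sum.distrib flip: sum_distrib_left)
    ultimately obtain y where y: "\<forall>k\<in>A \<times> B. y k \<in> \<int> \<and> y k \<approx> x' k"
      "\<forall>i\<in>A. (\<Sum>j\<in>B. y (i, j)) = 0" "\<forall>j\<in>B. (\<Sum>i\<in>A. y (i, j)) = 0"
      using less.hyps[of x'] by blast
    \<comment> \<open>Since \<open>x' k\<close> lies between the floor and the ceiling of
      \<open>x k\<close>, its rounding range is contained in that of \<open>x k\<close>.\<close>
    have "y k \<approx> x k" if "y k \<approx> x' k" for k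
    proof -
      have "\<lfloor>x k\<rfloor> \<le> \<lfloor>x' k\<rfloor>" "\<lceil>x' k\<rceil> \<le> \<lceil>x k\<rceil>"
        using approx[of k] by (auto simp: le_floor_iff ceiling_le_iff)
      then show ?thesis
        using that unfolding approx_def by linarith
    qed
    with y show ?thesis
      by blast
  qed
qed

text \<open>The matrix is bordered by its negated row and column sums and by its total, which makes
  all row and column sums vanish.\<close>

lemma round_matrix:
  fixes x :: "'a \<Rightarrow> 'b \<Rightarrow> real"
  assumes "finite A" "finite B"
  shows "\<exists>y :: 'a \<Rightarrow> 'b \<Rightarrow> int.
    (\<forall>i\<in>A. \<forall>j\<in>B. real_of_int (y i j) \<approx> x i j) \<and>
    (\<forall>i\<in>A. real_of_int (\<Sum>j\<in>B. y i j) \<approx> (\<Sum>j\<in>B. x i j)) \<and>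
    (\<forall>j\<in>B. real_of_int (\<Sum>i\<in>A. y i j) \<approx> (\<Sum>i\<in>A. x i j)) \<and>
    real_of_int (\<Sum>i\<in>A. \<Sum>j\<in>B. y i j) \<approx> (\<Sum>i\<in>A. \<Sum>j\<in>B. x i j)"
proof -
  define A' where "A' = insert None (Some ` A)"
  define B' where "B' = insert None (Some ` B)"
  define x' where "x' = (\<lambda>(i, j). case i of
      None \<Rightarrow> (case j of None \<Rightarrow> \<Sum>i\<in>A. \<Sum>j\<in>B. x i j | Some j \<Rightarrow> - (\<Sum>i\<in>A. x i j))
    | Some i \<Rightarrow> (case j of None \<Rightarrow> - (\<Sum>j\<in>B. x i j) | Some j \<Rightarrow> x i j))"
  have sumA: "(\<Sum>i\<in>A'. h i) = h None + (\<Sum>i\<in>A. h (Some i))" for h :: "'a option \<Rightarrow> real"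
    using assms by (simp add: A'_def sum.reindex)
  have sumB: "(\<Sum>j\<in>B'. h j) = h None + (\<Sum>j\<in>B. h (Some j))" for h :: "'b option \<Rightarrow> real"
    using assms by (simp add: B'_def sum.reindex)
  have "finite A'" "finite B'"
    using assms by (auto simp: A'_def B'_def)
  moreover have "(\<Sum>j\<in>B'. x' (i, j)) = 0" if "i \<in> A'" for i
    using that sum.swap[of x B A]
    by (cases i) (auto simp: sumB x'_def sum_negf)
  moreover have "(\<Sum>i\<in>A'. x' (i, j)) = 0" if "j \<in> B'" for j
    using that by (cases j) (auto simp: sumA x'_def sum_negf)
  ultimately obtain y' where round: "\<forall>k\<in>A' \<times> B'. y' k \<in> \<int> \<and> y' k \<approx> x' k"
    and zero: "\<forall>i\<in>A'. (\<Sum>j\<in>B'. y' (i, j)) = 0" "\<forall>j\<in>B'. (\<Sum>i\<in>A'. y' (i, j)) = 0"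
    using round_zero_sum_matrix[of A' B' x'] by blast
  note y' = bspec[OF round, of "(i, j)" for i j] zero
  \<comment> \<open>The values of \<open>y'\<close> used here are integers already; the floor only
    changes their type.\<close>
  define y where "y = (\<lambda>i j. \<lfloor>y' (Some i, Some j)\<rfloor>)"
  have y: "real_of_int (y i j) = y' (Some i, Some j)" if "i \<in> A" "j \<in> B" for i j
    using y'(1)[of "Some i" "Some j"] that by (auto simp: y_def A'_def B'_def elim: Ints_cases)
  have row: "(\<Sum>j\<in>B. real_of_int (y i j)) = - y' (Some i, None)" if "i \<in> A" for i
    using bspec[OF y'(2), of "Some i"] that by (simp add: sumB y A'_def)
  have col: "(\<Sum>i\<in>A. real_of_int (y i j)) = - y' (None, Some j)" if "j \<in> B" for j
    using bspec[OF y'(3), of "Some j"] that by (simp add: sumA y B'_def)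
  have total: "(\<Sum>i\<in>A. \<Sum>j\<in>B. real_of_int (y i j)) = y' (None, None)"
    using bspec[OF y'(3), of None] by (simp add: sumA row B'_def sum_negf)
  \<comment> \<open>Negation swaps floor and ceiling, so the negated border entries round the
    original row and column sums.\<close>
  have neg: "- a \<approx> b" if "a \<approx> - b" for a b :: real
    using that by (auto simp: approx_def ceiling_def)
  show ?thesis
  proof (intro exI[of _ y] conjI ballI)
    fix i j assume "i \<in> A" "j \<in> B"
    then show "real_of_int (y i j) \<approx> x i j"
      using y'(1)[of "Some i" "Some j"] by (simp add: y A'_def B'_def x'_def)
  next
    fix i assume "i \<in> A"
    then show "real_of_int (\<Sum>j\<in>B. y i j) \<approx> (\<Sum>j\<in>B. x i j)"
      using y'(1)[of "Some i" None] by (auto simp: row A'_def B'_def x'_def intro!: neg)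
  next
    fix j assume "j \<in> B"
    then show "real_of_int (\<Sum>i\<in>A. y i j) \<approx> (\<Sum>i\<in>A. x i j)"
      using y'(1)[of None "Some j"] by (auto simp: col A'_def B'_def x'_def intro!: neg)
  next
    show "real_of_int (\<Sum>i\<in>A. \<Sum>j\<in>B. y i j) \<approx> (\<Sum>i\<in>A. \<Sum>j\<in>B. x i j)"
      using y'(1)[of None None] by (simp add: total A'_def B'_def x'_def)
  qed
qed

section \<open>Balanced splitting of edges\<close>

lemma approx_of_int_iff: "of_int n \<approx> y \<longleftrightarrow> \<lfloor>y\<rfloor> \<le> n \<and> n \<le> \<lceil>y\<rceil>"
  by (simp add: approx_def)

lemma approx_of_nat_self: "real n \<approx> real n"
  by (simp add: approx_def)

text \<open>The integer \<open>n * \<lfloor>y / n\<rfloor>\<close> is at most \<open>y\<close>,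
  hence at most \<open>\<lfloor>y\<rfloor>\<close> and so at most \<open>x\<close>; dually for
  ceilings. Thus the range allowed by \<open>x / n\<close> lies within that of \<open>y / n\<close>.
  For \<open>n = 0\<close> both quotients are 0.\<close>

lemma approx_compose:
  fixes y :: real and n x :: nat
  assumes "real x \<approx> y" "z \<approx> real x / real n"
  shows "z \<approx> y / real n"
proof (cases "n = 0")
  case False
  have x: "of_int \<lfloor>y\<rfloor> \<le> real x" "real x \<le> of_int \<lceil>y\<rceil>"
    using assms(1) by (auto simp: approx_def)
  have "real_of_int \<lfloor>y / n\<rfloor> * n \<le> y"
    using False by (intro floor_divide_lower) simp
  then have "real_of_int (\<lfloor>y / n\<rfloor> * int n) \<le> y"
    by simp
  then have "\<lfloor>y / n\<rfloor> * int n \<le> \<lfloor>y\<rfloor>"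
    by (simp only: le_floor_iff)
  then have "real_of_int (\<lfloor>y / n\<rfloor> * int n) \<le> real x"
    using x(1) by linarith
  then have "\<lfloor>y / n\<rfloor> \<le> \<lfloor>real x / n\<rfloor>"
    using False by (simp add: le_floor_iff pos_le_divide_eq)
  moreover have "real_of_int \<lceil>y / n\<rceil> * n \<ge> y"
    using False by (intro ceiling_divide_upper) simp
  then have "real_of_int (\<lceil>y / n\<rceil> * int n) \<ge> y"
    by simp
  then have "\<lceil>y / n\<rceil> * int n \<ge> \<lceil>y\<rceil>"
    by (simp only: ceiling_le_iff)
  then have "real_of_int (\<lceil>y / n\<rceil> * int n) \<ge> real x"
    using x(2) by linarith
  then have "\<lceil>y / n\<rceil> \<ge> \<lceil>real x / n\<rceil>"
    using False by (simp add: ceiling_le_iff pos_divide_le_eq)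
  ultimately show ?thesis
    using assms(2) unfolding approx_def by linarith
qed (use assms in simp)

text \<open>Subtraction from an integer reflects the rounding range. This turns an estimate of what
  has been chosen into one of what is left.\<close>

lemma approx_diff:
  assumes "x \<approx> y"
  shows "real n - x \<approx> real n - y"
proof -
  have "\<lfloor>real n - y\<rfloor> = int n - \<lceil>y\<rceil>" "\<lceil>real n - y\<rceil> = int n - \<lfloor>y\<rfloor>"
    by linarith+
  then show ?thesis
    using assms by (simp add: approx_def)
qed

section \<open>Choosing a balanced set of edges\<close>

text \<open>Quantifying over these sets treats the statements for all edges (\<open>UNIV\<close>)
  and for a single color (\<open>{j}\<close>) together.\<close>

abbreviation color_sets :: "'c set set" where
  "color_sets \<equiv> insert UNIV (range (\<lambda>j. {j}))"

lemma sum_by_type: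
  fixes h :: "'e \<Rightarrow> 'a :: comm_monoid_add"
  assumes "finite E" "t ` E \<subseteq> B" "finite B"
  shows "(\<Sum>e | e \<in> E \<and> P e. h e) = (\<Sum>s\<in>B. \<Sum>e | e \<in> E \<and> P e \<and> t e = s. h e)"
proof -
  have "(\<Sum>s\<in>B. sum h {e \<in> {e \<in> E. P e}. t e = s}) = sum h {e \<in> E. P e}"
    using assms by (intro sum.group) auto
  then show ?thesis
    by (simp add: conj_assoc)
qed

text \<open>Edges of equal color and type have equal weight, so only the number chosen from each
  such cell matters. The numbers come from \<open>round_matrix\<close>: its entries, column sums,
  row sums and total control color and type, type, color, and all edges.\<close>

lemma round_subset:
  fixes f :: "'e \<Rightarrow> 'c" and t :: "'e \<Rightarrow> 't" and w :: "'t \<Rightarrow> real"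
  assumes "finite E" and w: "\<And>e. e \<in> E \<Longrightarrow> 0 \<le> w (t e) \<and> w (t e) \<le> 1"
  obtains X where "X \<subseteq> E"
    and "\<And>e. e \<in> X \<Longrightarrow> w (t e) \<noteq> 0" and "\<And>e. e \<in> E - X \<Longrightarrow> w (t e) \<noteq> 1"
    and "\<And>J. J \<in> color_sets \<Longrightarrow>
      real (card {e \<in> X. f e \<in> J}) \<approx> (\<Sum>e | e \<in> E \<and> f e \<in> J. w (t e))"
    and "\<And>J s. J \<in> color_sets \<Longrightarrow>
      real (card {e \<in> X. f e \<in> J \<and> t e = s}) \<approx> w s * real (card {e \<in> E. f e \<in> J \<and> t e = s})"
proof -
  define cell where "cell = (\<lambda>c s. {e \<in> E. f e = c \<and> t e = s})"
  define x where "x = (\<lambda>c s. w s * real (card (cell c s)))"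
  obtain y :: "'c \<Rightarrow> 't \<Rightarrow> int" where
    y0: "\<forall>i\<in>f ` E. \<forall>j\<in>t ` E. real_of_int (y i j) \<approx> x i j" and
    row0: "\<forall>i\<in>f ` E. real_of_int (\<Sum>j\<in>t ` E. y i j) \<approx> (\<Sum>j\<in>t ` E. x i j)" and
    col0: "\<forall>j\<in>t ` E. real_of_int (\<Sum>i\<in>f ` E. y i j) \<approx> (\<Sum>i\<in>f ` E. x i j)" and
    total: "real_of_int (\<Sum>i\<in>f ` E. \<Sum>j\<in>t ` E. y i j) \<approx> (\<Sum>i\<in>f ` E. \<Sum>j\<in>t ` E. x i j)"
    using round_matrix[OF finite_imageI[OF assms(1)] finite_imageI[OF assms(1)], of f t x] by blast
  note y = bspec[OF bspec[OF y0]] and row = bspec[OF row0] and col = bspec[OF col0]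
  \<comment> \<open>Weights between 0 and 1 keep each rounded entry between 0 and the cell size, so
    that many edges can be picked.\<close>
  have y_bounds: "0 \<le> y c s \<and> y c s \<le> int (card (cell c s))" if "c \<in> f ` E" "s \<in> t ` E" for c s
  proof -
    have "0 \<le> x c s"
      using w that by (auto simp: x_def)
    moreover have "x c s \<le> real (card (cell c s))"
      using w that by (auto simp: x_def mult_left_le_one_le)
    then have "\<lceil>x c s\<rceil> \<le> int (card (cell c s))"
      by (simp add: ceiling_le_iff)
    ultimately show ?thesis
      using y[OF that] by (simp add: approx_of_int_iff) linarith
  qed
  have "\<exists>Y. Y \<subseteq> cell c s \<and> card Y = nat (y c s)" if "c \<in> f ` E" "s \<in> t ` E" for c s
  proof -
    have "nat (y c s) \<le> card (cell c s)"
      using y_bounds[OF that] by linarith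
    from obtain_subset_with_card_n[OF this] show ?thesis
      by blast
  qed
  then obtain Y where Y: "\<And>c s. c \<in> f ` E \<Longrightarrow> s \<in> t ` E \<Longrightarrow> Y c s \<subseteq> cell c s \<and> card (Y c s) = nat (y c s)"
    by metis
  define X where "X = {e \<in> E. e \<in> Y (f e) (t e)}"
  have XE: "X \<subseteq> E" and finX: "finite X"
    using assms(1) by (auto simp: X_def)
  have "{e \<in> X. f e = c \<and> t e = s} = Y c s" if "c \<in> f ` E" "s \<in> t ` E" for c s
    using Y[OF that] by (auto simp: X_def cell_def)
  then have card_cell: "real (card {e \<in> X. f e = c \<and> t e = s}) = of_int (y c s)"
    if "c \<in> f ` E" "s \<in> t ` E" for c s
    using Y[OF that] y_bounds[OF that] that by simp
  have X_cell: "e \<in> X \<longleftrightarrow> e \<in> Y (f e) (t e)" if "e \<in> E" for e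
    using that by (simp add: X_def)
  have finY: "finite (Y (f e) (t e))" if "e \<in> E" for e
    using Y[of "f e" "t e"] that assms(1) by (auto simp: cell_def intro: finite_subset)
  \<comment> \<open>For weight 0 or 1 the cell entry is the integer 0 or the full cell size.
    Rounding keeps it, so the cell is avoided or taken entirely.\<close>
  have "w (t e) \<noteq> 0" if "e \<in> X" for e
  proof
    assume "w (t e) = 0"
    then have "y (f e) (t e) = 0"
      using y[of "f e" "t e"] that XE by (auto simp: x_def approx_def)
    then show False
      using Y[of "f e" "t e"] X_cell[of e] finY[of e] that XE by auto
  qed
  moreover have "w (t e) \<noteq> 1" if "e \<in> E - X" for e
  proof
    assume "w (t e) = 1"
    then have "y (f e) (t e) = int (card (cell (f e) (t e)))"
      using y[of "f e" "t e"] that by (auto simp: x_def approx_def)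
    then have "Y (f e) (t e) = cell (f e) (t e)"
      using Y[of "f e" "t e"] that assms(1) by (intro card_subset_eq) (auto simp: cell_def)
    then show False
      using that by (auto simp: X_def cell_def)
  qed
  moreover have "real (card {e \<in> X. f e \<in> J \<and> t e = s}) \<approx> w s * real (card {e \<in> E. f e \<in> J \<and> t e = s})"
    if "J \<in> color_sets" for J s
  proof (cases "s \<in> t ` E")
    case s: True
    \<comment> \<open>\<open>UNIV\<close> leads to a column sum and an occurring color to a single
      entry; for a color that does not occur both counts are 0.\<close>
    consider "J = UNIV" | c where "J = {c}" "c \<in> f ` E" | c where "J = {c}" "c \<notin> f ` E"
      using \<open>J \<in> color_sets\<close> by blast
    then show ?thesis
    proof cases
      case 1
      have "real (card {e \<in> X. t e = s}) = (\<Sum>c\<in>f ` E. real_of_int (y c s))"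
        using sum_by_type[OF finX, of f "f ` E" "\<lambda>_. 1 :: real" "\<lambda>e. t e = s"] XE assms(1)
        by (simp add: image_mono card_cell s conj_commute)
      moreover have "w s * real (card {e \<in> E. t e = s}) = (\<Sum>c\<in>f ` E. x c s)"
        using sum_by_type[OF assms(1), of f "f ` E" "\<lambda>_. 1 :: real" "\<lambda>e. t e = s"] assms(1)
        by (simp add: x_def cell_def conj_commute sum_distrib_left)
      ultimately show ?thesis
        using 1 col[OF s] by simp
    next
      case 2
      then show ?thesis
        using y[OF 2(2) s] card_cell[OF 2(2) s] by (simp add: x_def cell_def)
    next
      case 3
      then have "{e \<in> X. f e \<in> J \<and> t e = s} = {}" "{e \<in> E. f e \<in> J \<and> t e = s} = {}"
        using XE by auto
      then show ?thesis
        by (simp only:) (simp add: approx_def)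
    qed
  next
    case False
    then have "{e \<in> X. f e \<in> J \<and> t e = s} = {}" "{e \<in> E. f e \<in> J \<and> t e = s} = {}"
      using XE by auto
    then show ?thesis
      by (simp only:) (simp add: approx_def)
  qed
  moreover have "real (card {e \<in> X. f e \<in> J}) \<approx> (\<Sum>e | e \<in> E \<and> f e \<in> J. w (t e))"
    if "J \<in> color_sets" for J
  proof -
    have rowX: "real (card {e \<in> X. f e = c}) = (\<Sum>s\<in>t ` E. real_of_int (y c s))" if "c \<in> f ` E" for c
      using sum_by_type[OF finX, of t "t ` E" "\<lambda>_. 1 :: real" "\<lambda>e. f e = c"] XE assms(1)
      by (simp add: image_mono card_cell that)
    have rowE: "(\<Sum>e | e \<in> E \<and> f e = c. w (t e)) = (\<Sum>s\<in>t ` E. x c s)" for c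
      using sum_by_type[OF assms(1), of t "t ` E" "\<lambda>e. w (t e)" "\<lambda>e. f e = c"] assms(1)
      by (simp add: x_def cell_def mult.commute)
    consider "J = UNIV" | c where "J = {c}" "c \<in> f ` E" | c where "J = {c}" "c \<notin> f ` E"
      using \<open>J \<in> color_sets\<close> by blast
    then show ?thesis
    proof cases
      case 1
      have "real (card X) = (\<Sum>c\<in>f ` E. \<Sum>s\<in>t ` E. real_of_int (y c s))"
        using sum_by_type[OF finX, of f "f ` E" "\<lambda>_. 1 :: real" "\<lambda>_. True"] XE assms(1)
        by (simp add: image_mono rowX)
      moreover have "(\<Sum>e\<in>E. w (t e)) = (\<Sum>c\<in>f ` E. \<Sum>s\<in>t ` E. x c s)"
        using sum_by_type[OF assms(1), of f "f ` E" "\<lambda>e. w (t e)" "\<lambda>_. True"] assms(1)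
        by (simp add: rowE)
      ultimately show ?thesis
        using 1 total by simp
    next
      case 2
      then show ?thesis
        using row[OF 2(2)] by (simp add: rowX rowE)
    next
      case 3
      then have "{e \<in> X. f e \<in> J} = {}" "{e \<in> E. f e \<in> J} = {}"
        using XE by auto
      then show ?thesis
        by (simp only:) (simp add: approx_def)
    qed
  qed
  ultimately show ?thesis
    using that XE by blast
qed

section \<open>Distributing edges over slots\<close>

text \<open>The vertices of the detachment: \<open>(u, i)\<close> is the vertex number
  \<open>i\<close>, counted from 0, among the \<open>r u\<close> vertices into which
  \<open>u\<close> is split.\<close>

definition slots :: "('v \<Rightarrow> nat) \<Rightarrow> ('v \<times> nat) set" where
  "slots r = {(u, i). i < r u}"

text \<open>For \<open>W\<close> within some \<open>slots r\<close>, the multiplicity function of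
  the multiset that arises from \<open>W\<close> when slots are merged back into their
  vertices.\<close>

definition cnt :: "('v \<times> nat) set \<Rightarrow> 'v \<Rightarrow> nat" where
  "cnt W u = card {i. (u, i) \<in> W}"

lemma finite_slots_section: "W \<subseteq> slots r \<Longrightarrow> finite {i. (u, i) \<in> W}"
  by (rule finite_subset[of _ "{..<r u}"]) (auto simp: slots_def)

lemma cnt_le: "W \<subseteq> slots r \<Longrightarrow> cnt W u \<le> r u"
  using card_mono[of "{..<r u}" "{i. (u, i) \<in> W}"] by (auto simp: slots_def cnt_def)

lemma cnt_insert:
  assumes "W \<subseteq> slots r" "(a, i) \<notin> W"
  shows "cnt (insert (a, i) W) = (cnt W)(a := Suc (cnt W a))"
proof
  fix u
  have "{j. (u, j) \<in> insert (a, i) W} = (if u = a then insert i {j. (a, j) \<in> W} else {j. (u, j) \<in> W})"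
    by auto
  then show "cnt (insert (a, i) W) u = ((cnt W)(a := Suc (cnt W a))) u"
    using assms finite_slots_section[OF assms(1), of a] by (simp add: cnt_def)
qed

text \<open>The slot with the largest index at a vertex \<open>a\<close> receives a rounded fraction \<open>1 / r a\<close> of
  the edges. The labels remember these choices, so that the induction hypothesis also separates
  edges that differ only in the slots treated before.\<close>

lemma balanced_split:
  fixes d :: "'e \<Rightarrow> 'v \<Rightarrow> nat" and f :: "'e \<Rightarrow> 'c" and lab :: "'e \<Rightarrow> bool list"
  assumes "finite E" "finite V"
    and "\<forall>e\<in>E. \<forall>u. d e u \<le> r u" and "\<forall>u. u \<notin> V \<longrightarrow> r u = 0"
  shows "\<exists>T. (\<forall>e\<in>E. T e \<subseteq> slots r \<and> cnt (T e) = d e) \<and>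
    (\<forall>J\<in>color_sets. \<forall>u i. i < r u \<longrightarrow>
      real (card {e \<in> E. f e \<in> J \<and> (u, i) \<in> T e}) \<approx>
        real (\<Sum>e | e \<in> E \<and> f e \<in> J. d e u) / real (r u)) \<and>
    (\<forall>J\<in>color_sets. \<forall>l. \<forall>W \<subseteq> slots r.
      real (card {e \<in> E. f e \<in> J \<and> lab e = l \<and> T e = W}) \<approx>
        real (card {e \<in> E. f e \<in> J \<and> lab e = l \<and> d e = cnt W}) /
          real (\<Prod>u\<in>V. r u choose cnt W u))"
  using assms(3,4)
proof (induction "sum r V" arbitrary: r d lab rule: less_induct)
  case (less r d lab)
  note d_le = less.prems(1)[rule_format] and r_out = less.prems(2)[rule_format]
  show ?case
  proof (cases "\<exists>a. r a > 0")
    case False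
    then have r: "r = (\<lambda>_. 0)"
      by auto
    have d: "d e = (\<lambda>_. 0)" if "e \<in> E" for e
      using d_le[OF that] r by auto
    have cnt0: "cnt {} = (\<lambda>_. 0 :: nat)" and slots0: "slots (\<lambda>_. 0) = {}"
      by (auto simp: cnt_def slots_def)
    have eq: "{e \<in> E. f e \<in> J \<and> lab e = l \<and> d e = (\<lambda>_. 0)} = {e \<in> E. f e \<in> J \<and> lab e = l}" for J l
      using d by auto
    show ?thesis
      by (intro exI[of _ "\<lambda>_. {}"]) (simp add: slots0 cnt0 d eq r approx_of_nat_self)
  next
    case True
    then obtain a where a: "r a > 0"
      by blast
    define c where "c = r a"
    have c: "c > 0" "r a = c"
      using a by (simp_all add: c_def)
    have aV: "a \<in> V"
      using a r_out[of a] by auto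
    \<comment> \<open>Indices start at 0, so \<open>c - 1\<close> is the last one and removing
      \<open>b\<close> leaves exactly \<open>slots r'\<close>.\<close>
    define b where "b = (a, c - 1)"
    define r' where "r' = r(a := c - 1)"
    \<comment> \<open>The type of an edge comprises its label and its whole function
      \<open>d e\<close>, although the weight depends only on the value at \<open>a\<close>; this
      makes \<open>split\<close> an estimate for each label and each multiplicity pattern.\<close>
    define w :: "bool list \<times> ('v \<Rightarrow> nat) \<Rightarrow> real" where "w = (\<lambda>(l, \<delta>). real (\<delta> a) / real c)"
    have "0 \<le> w (lab e, d e) \<and> w (lab e, d e) \<le> 1" if "e \<in> E" for e
      using d_le[OF that, of a] c by (simp add: w_def)
    from round_subset[OF assms(1), of w "\<lambda>e. (lab e, d e)" f, OF this] obtain X where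
      X: "X \<subseteq> E" "\<And>e. e \<in> X \<Longrightarrow> w (lab e, d e) \<noteq> 0" "\<And>e. e \<in> E - X \<Longrightarrow> w (lab e, d e) \<noteq> 1"
      and deg: "\<And>J. J \<in> color_sets \<Longrightarrow>
        real (card {e \<in> X. f e \<in> J}) \<approx> (\<Sum>e | e \<in> E \<and> f e \<in> J. w (lab e, d e))"
      and split: "\<And>J s. J \<in> color_sets \<Longrightarrow>
        real (card {e \<in> X. f e \<in> J \<and> (lab e, d e) = s}) \<approx>
          w s * real (card {e \<in> E. f e \<in> J \<and> (lab e, d e) = s})"
      by blast
    \<comment> \<open>Chosen edges have a hinge to spend on \<open>b\<close>; the hinges of any
      other edge at \<open>a\<close> still fit into the remaining \<open>c - 1\<close>
      slots.\<close>
    have dX: "d e a > 0" if "e \<in> X" for e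
      using X(2)[OF that] c by (simp add: w_def)
    have dnX: "d e a < c" if "e \<in> E" "e \<notin> X" for e
      using X(3)[of e] d_le[OF that(1), of a] that c by (simp add: w_def)
    define d' where "d' = (\<lambda>e. (d e)(a := d e a - of_bool (e \<in> X)))"
    define lab' where "lab' = (\<lambda>e. (e \<in> X) # lab e)"
    have "sum r' V < sum r V"
      using assms(2) aV c by (intro sum_strict_mono_ex1) (auto simp: r'_def)
    moreover have "\<forall>e\<in>E. \<forall>u. d' e u \<le> r' u"
    proof (intro ballI allI)
      fix e u assume "e \<in> E"
      then show "d' e u \<le> r' u"
        using d_le[of e u] dnX[of e] c by (auto simp: d'_def r'_def)
    qed
    moreover have "\<forall>u. u \<notin> V \<longrightarrow> r' u = 0"
      using r_out aV by (auto simp: r'_def)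
    ultimately obtain T' where
      T'0: "\<forall>e\<in>E. T' e \<subseteq> slots r' \<and> cnt (T' e) = d' e"
      and deg'0: "\<forall>J\<in>color_sets. \<forall>u i. i < r' u \<longrightarrow>
        real (card {e \<in> E. f e \<in> J \<and> (u, i) \<in> T' e}) \<approx>
          real (\<Sum>e | e \<in> E \<and> f e \<in> J. d' e u) / real (r' u)"
      and mult'0: "\<forall>J\<in>color_sets. \<forall>l. \<forall>W \<subseteq> slots r'.
        real (card {e \<in> E. f e \<in> J \<and> lab' e = l \<and> T' e = W}) \<approx>
          real (card {e \<in> E. f e \<in> J \<and> lab' e = l \<and> d' e = cnt W}) /
            real (\<Prod>u\<in>V. r' u choose cnt W u)"
      using less.hyps[of r' d' lab'] by blast
    note T' = conjunct1[OF bspec[OF T'0]] conjunct2[OF bspec[OF T'0]]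
    note deg' = bspec[OF deg'0, rule_format] and mult' = bspec[OF mult'0, rule_format]
    have slots: "slots r = insert b (slots r')" "b \<notin> slots r'"
      using c by (auto simp: slots_def r'_def b_def split: if_splits)
    have bT': "b \<notin> T' e" if "e \<in> E" for e
      using T'(1)[OF that] slots(2) by blast
    define T where "T = (\<lambda>e. if e \<in> X then insert b (T' e) else T' e)"
    show ?thesis
    proof (intro exI[of _ T] conjI ballI allI impI)
      fix e assume e: "e \<in> E"
      show "T e \<subseteq> slots r"
        using T'(1)[OF e] slots(1) by (auto simp: T_def)
      show "cnt (T e) = d e"
        using cnt_insert[OF T'(1)[OF e] bT'[OF e, unfolded b_def]] T'(2)[OF e] dX[of e]
        by (auto simp: T_def b_def d'_def fun_eq_iff)
    next
      fix J :: "'c set" and u :: 'v and i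
      assume J: "J \<in> color_sets" and i: "i < r u"
      let ?D = "\<lambda>u. \<Sum>e | e \<in> E \<and> f e \<in> J. d e u"
      have degX: "real (card {e \<in> X. f e \<in> J}) \<approx> real (?D a) / real c"
        using deg[OF J] by (simp add: w_def sum_divide_distrib)
      \<comment> \<open>The new slot is governed by the rounding \<open>degX\<close>, slots at other
        vertices by the induction hypothesis alone, and the remaining slots at \<open>a\<close> by
        both.\<close>
      consider "(u, i) = b" | "u \<noteq> a" | "u = a" "i < c - 1"
        using i c by (fastforce simp: b_def)
      then show "real (card {e \<in> E. f e \<in> J \<and> (u, i) \<in> T e}) \<approx> real (?D u) / real (r u)"
      proof cases
        case 1
        then have "{e \<in> E. f e \<in> J \<and> (u, i) \<in> T e} = {e \<in> X. f e \<in> J}"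
          using bT' X(1) by (auto simp: T_def split: if_splits)
        then show ?thesis
          using degX 1 c by (simp add: b_def)
      next
        case 2
        then have "{e \<in> E. f e \<in> J \<and> (u, i) \<in> T e} = {e \<in> E. f e \<in> J \<and> (u, i) \<in> T' e}"
          by (auto simp: T_def b_def split: if_splits)
        then show ?thesis
          using deg'[OF J, of i u] 2 i by (simp add: r'_def d'_def)
      next
        case 3
        then have eq: "{e \<in> E. f e \<in> J \<and> (u, i) \<in> T e} = {e \<in> E. f e \<in> J \<and> (u, i) \<in> T' e}"
          by (auto simp: T_def b_def split: if_splits)
        have sumX: "(\<Sum>e | e \<in> E \<and> f e \<in> J. of_bool (e \<in> X) :: nat) = card {e \<in> X. f e \<in> J}"
        proof -
          have "{e \<in> E. f e \<in> J} \<inter> {e. e \<in> X} = {e \<in> X. f e \<in> J}"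
            using X(1) by auto
          then show ?thesis
            using assms(1) by (simp add: of_bool_def sum.If_cases)
        qed
        have "?D a = (\<Sum>e | e \<in> E \<and> f e \<in> J. d' e a + of_bool (e \<in> X))"
          using dX by (intro sum.cong) (auto simp: d'_def)
        also have "\<dots> = (\<Sum>e | e \<in> E \<and> f e \<in> J. d' e a) + card {e \<in> X. f e \<in> J}"
          by (simp only: sum.distrib sumX)
        finally have D': "real (\<Sum>e | e \<in> E \<and> f e \<in> J. d' e a) = real (?D a) - real (card {e \<in> X. f e \<in> J})"
          by simp
        \<comment> \<open>With \<open>D\<close> hinges at \<open>a\<close>, about
          \<open>D - D / c\<close> remain, and an equal share among \<open>c - 1\<close> slots is
          again \<open>D / c\<close>.\<close>
        have "real (\<Sum>e | e \<in> E \<and> f e \<in> J. d' e a) \<approx> real (?D a) - real (?D a) / real c"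
          unfolding D' by (rule approx_diff[OF degX])
        moreover have "real (card {e \<in> E. f e \<in> J \<and> (a, i) \<in> T' e}) \<approx>
            real (\<Sum>e | e \<in> E \<and> f e \<in> J. d' e a) / real (c - 1)"
          using deg'[OF J, of i a] 3 by (simp add: r'_def)
        ultimately have "real (card {e \<in> E. f e \<in> J \<and> (a, i) \<in> T' e}) \<approx>
            (real (?D a) - real (?D a) / real c) / real (c - 1)"
          by (rule approx_compose)
        also have "(real (?D a) - real (?D a) / real c) / real (c - 1) = real (?D a) / real c"
          using c 3 by (simp add: of_nat_diff field_simps)
        finally show ?thesis
          using eq 3 c by simp
      qed
    next
      fix J :: "'c set" and l W
      assume J: "J \<in> color_sets" and W: "W \<subseteq> slots r"
      define p where "p = cnt W a"
      define P where "P = (\<Prod>u\<in>V - {a}. r u choose cnt W u)"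
      let ?N = "card {e \<in> E. f e \<in> J \<and> lab e = l \<and> d e = cnt W}"
      let ?x = "card {e \<in> X. f e \<in> J \<and> lab e = l \<and> d e = cnt W}"
      have prod: "(\<Prod>u\<in>V. r u choose cnt W u) = (c choose p) * P"
        using assms(2) aV c by (simp add: prod.remove P_def p_def)
      have splitX: "real ?x \<approx> real p / real c * real ?N"
        using split[OF J, of "(l, cnt W)"] by (simp add: w_def p_def)
      show "real (card {e \<in> E. f e \<in> J \<and> lab e = l \<and> T e = W}) \<approx>
          real ?N / real (\<Prod>u\<in>V. r u choose cnt W u)"
      proof (cases "b \<in> W")
        case True
        define W' where "W' = W - {b}"
        have W': "W' \<subseteq> slots r'" "W = insert b W'" "b \<notin> W'"
          using W True slots(1) by (auto simp: W'_def)
        have cntW: "cnt W = (cnt W')(a := Suc (cnt W' a))"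
          using cnt_insert[OF W'(1) W'(3)[unfolded b_def]] W'(2) by (simp add: b_def)
        have eq1: "{e \<in> E. f e \<in> J \<and> lab e = l \<and> T e = W} =
            {e \<in> E. f e \<in> J \<and> lab' e = True # l \<and> T' e = W'}"
        proof -
          have "(lab e = l \<and> T e = W) = (lab' e = True # l \<and> T' e = W')" if "e \<in> E" for e
            using bT'[OF that] W'(2,3) by (auto simp: T_def lab'_def)
          then show ?thesis
            by blast
        qed
        \<comment> \<open>The label \<open>True # l\<close> selects chosen edges, for which the
          reduced pattern \<open>cnt W'\<close> means the original pattern \<open>cnt W\<close>. So
          the induction hypothesis refers to \<open>?x\<close>, which \<open>splitX\<close>
          estimates.\<close>
        have eq2: "{e \<in> E. f e \<in> J \<and> lab' e = True # l \<and> d' e = cnt W'} =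
            {e \<in> X. f e \<in> J \<and> lab e = l \<and> d e = cnt W}"
        proof -
          have "d' e = cnt W' \<longleftrightarrow> d e = cnt W" if "e \<in> X" for e
            using dX[OF that] that by (auto simp: d'_def cntW fun_eq_iff)
          then show ?thesis
            using X(1) by (auto simp: lab'_def)
        qed
        have p: "p = Suc (p - 1)" "cnt W' a = p - 1" "c = Suc (c - 1)"
          using cntW c by (simp_all add: p_def)
        have prod': "(\<Prod>u\<in>V. r' u choose cnt W' u) = ((c - 1) choose (p - 1)) * P"
        proof -
          have "(\<Prod>u\<in>V - {a}. r' u choose cnt W' u) = P"
            unfolding P_def by (intro prod.cong) (auto simp: r'_def cntW)
          then show ?thesis
            using assms(2) aV p by (simp add: prod.remove r'_def)
        qed
        have "real (card {e \<in> E. f e \<in> J \<and> lab e = l \<and> T e = W}) \<approx>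
            real ?x / real (((c - 1) choose (p - 1)) * P)"
          using mult'[OF J W'(1), of "True # l"] unfolding eq1 eq2 prod' .
        then have "real (card {e \<in> E. f e \<in> J \<and> lab e = l \<and> T e = W}) \<approx>
            real p / real c * real ?N / real (((c - 1) choose (p - 1)) * P)"
          by (rule approx_compose[OF splitX])
        \<comment> \<open>Absorption identity for binomial coefficients; \<open>p\<close> is
          positive because \<open>b\<close> lies in \<open>W\<close>.\<close>
        also have "real p / real c * real ?N / real (((c - 1) choose (p - 1)) * P) =
            real ?N / real ((c choose p) * P)"
        proof -
          have "p * (c choose p) = c * ((c - 1) choose (p - 1))"
            using Suc_times_binomial[of "p - 1" "c - 1"] p by metis
          then have "real p * real (c choose p) = real c * real ((c - 1) choose (p - 1))"
            by (metis of_nat_mult)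
          moreover have pos: "p \<le> c" "(c choose p) > 0" "((c - 1) choose (p - 1)) > 0"
            using cnt_le[OF W, of a] c by (auto simp: p_def)
          ultimately have "real p / real c = real ((c - 1) choose (p - 1)) / real (c choose p)"
            using c by (simp add: frac_eq_eq mult.commute)
          then show ?thesis
            using pos by simp
        qed
        finally show ?thesis
          by (simp only: prod)
      next
        case False
        then have W': "W \<subseteq> slots r'"
          using W slots(1) by auto
        \<comment> \<open>Since \<open>W\<close> misses the last slot of \<open>a\<close>, both
          \<open>c - p\<close> and the binomial \<open>(c - 1) choose p\<close> are
          positive.\<close>
        have p: "p \<le> c - 1"
          using cnt_le[OF W', of a] by (simp add: p_def r'_def)
        have eq1: "{e \<in> E. f e \<in> J \<and> lab e = l \<and> T e = W} =
            {e \<in> E. f e \<in> J \<and> lab' e = False # l \<and> T' e = W}"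
          using False by (auto simp: T_def lab'_def)
        \<comment> \<open>Edges that were not chosen keep their pattern, so this count is the
          complement \<open>?N - ?x\<close>.\<close>
        have eq2: "{e \<in> E. f e \<in> J \<and> lab' e = False # l \<and> d' e = cnt W} =
            {e \<in> E. f e \<in> J \<and> lab e = l \<and> d e = cnt W} -
            {e \<in> X. f e \<in> J \<and> lab e = l \<and> d e = cnt W}"
          by (auto simp: lab'_def d'_def)
        have sub: "{e \<in> X. f e \<in> J \<and> lab e = l \<and> d e = cnt W} \<subseteq>
            {e \<in> E. f e \<in> J \<and> lab e = l \<and> d e = cnt W}"
          using X(1) by auto
        have finX: "finite {e \<in> X. f e \<in> J \<and> lab e = l \<and> d e = cnt W}"
          using X(1) assms(1) by (auto intro: finite_subset)
        have "card {e \<in> E. f e \<in> J \<and> lab' e = False # l \<and> d' e = cnt W} = ?N - ?x"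
          unfolding eq2 by (rule card_Diff_subset[OF finX sub])
        moreover have "?x \<le> ?N"
          using sub assms(1) by (intro card_mono) auto
        ultimately have diff: "real (card {e \<in> E. f e \<in> J \<and> lab' e = False # l \<and> d' e = cnt W}) \<approx>
            real ?N - real p / real c * real ?N"
          using approx_diff[OF splitX, of ?N] by (simp add: of_nat_diff)
        have prod': "(\<Prod>u\<in>V. r' u choose cnt W u) = ((c - 1) choose p) * P"
        proof -
          have "(\<Prod>u\<in>V - {a}. r' u choose cnt W u) = P"
            unfolding P_def by (intro prod.cong) (auto simp: r'_def)
          then show ?thesis
            using assms(2) aV by (simp add: prod.remove r'_def p_def)
        qed
        have "real (card {e \<in> E. f e \<in> J \<and> lab e = l \<and> T e = W}) \<approx>
            (real ?N - real p / real c * real ?N) / real (((c - 1) choose p) * P)"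
          using approx_compose[OF diff mult'[OF J W', of "False # l", unfolded prod']]
          unfolding eq1 .
        also have "(real ?N - real p / real c * real ?N) / real (((c - 1) choose p) * P) =
            real ?N / real ((c choose p) * P)"
        proof -
          have "(c - p) * (c choose p) = c * ((c - 1) choose p)"
            by (rule binomial_absorb_comp)
          then have *: "(real c - real p) * real (c choose p) = real c * real ((c - 1) choose p)"
            using p by (metis of_nat_mult of_nat_diff diff_le_self le_trans)
          have pos: "real c - real p > 0" "real c > 0" "(c choose p) > 0" "((c - 1) choose p) > 0"
            using p c by auto
          have "(real ?N - real p / real c * real ?N) = (real c - real p) / real c * real ?N"
            using pos by (simp add: field_simps)
          moreover have "(real c - real p) / real c = real ((c - 1) choose p) / real (c choose p)"
            using * pos by (simp add: field_simps)
          ultimately show ?thesis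
            using pos by simp
        qed
        finally show ?thesis
          by (simp only: prod)
      qed
    qed
  qed
qed

section \<open>Hypergraphs\<close>

lemma color_class_simps:
  "verts (color_class G f j) = verts G" "edges (color_class G f j) = {e \<in> edges G. f e = j}"
  by (simp_all add: color_class_def)

lemma hinges_between_color_class:
  "f e = j \<Longrightarrow> hinges_between (color_class G f j) v e = hinges_between G v e"
  by (auto simp: hinges_between_def color_class_def)

lemma hypergraph_color_class: "hypergraph G \<Longrightarrow> hypergraph (color_class G f j)"
  by (auto simp: hypergraph_def color_class_def)

text \<open>Grouping the hinges at \<open>v\<close> by their edges brings degrees into the form
  estimated by \<open>balanced_split\<close>.\<close>

lemma degree_eq_sum:
  assumes "hypergraph G"
  shows "degree G v = (\<Sum>e\<in>edges G. card (hinges_between G v e))"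
proof -
  have fin: "finite (hinges_at G v)" "finite (edges G)" and im: "edge_of G ` hinges_at G v \<subseteq> edges G"
    using assms by (auto simp: hypergraph_def hinges_at_def)
  have "{h \<in> hinges_at G v. edge_of G h = e} = hinges_between G v e" for e
    by (auto simp: hinges_at_def hinges_between_def)
  then show ?thesis
    using sum.group[OF fin im, of "\<lambda>_. 1 :: nat"] by (simp add: degree_def)
qed

lemma degree_color_class_eq_sum:
  assumes "hypergraph G"
  shows "degree (color_class G f j) v = (\<Sum>e | e \<in> edges G \<and> f e = j. card (hinges_between G v e))"
  using degree_eq_sum[OF hypergraph_color_class[OF assms], of f j v]
  by (simp add: hinges_between_color_class color_class_simps)

lemma multiplicity_color_class:
  "multiplicity (color_class G f j) U =
    card {e \<in> edges G. f e = j \<and> (\<forall>v\<in>verts G. card (hinges_between G v e) = count U v)}"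
  unfolding multiplicity_def edges_on_def
  by (rule arg_cong[of _ _ card]) (auto simp: color_class_simps hinges_between_color_class)

text \<open>The sets \<open>U i\<close> lie over distinct vertices, so at most one summand
  contributes to each count. This replaces the two multisets of the theorem by a single set of
  slots, its indicator and its \<open>cnt\<close>.\<close>

lemma
  fixes u :: "'i \<Rightarrow> 'v" and U :: "'i \<Rightarrow> ('v \<times> nat) set"
  assumes "finite I" "inj_on u I"
    and "\<And>i. i \<in> I \<Longrightarrow> finite (U i)" "\<And>i v. i \<in> I \<Longrightarrow> v \<in> U i \<Longrightarrow> fst v = u i"
  shows count_sum_mset_set: "count (\<Sum>i\<in>I. mset_set (U i)) v = of_bool (v \<in> (\<Union>i\<in>I. U i))"
    and count_sum_replicate_mset:
      "count (\<Sum>i\<in>I. replicate_mset (card (U i)) (u i)) w = cnt (\<Union>i\<in>I. U i) w"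
proof -
  have "count (\<Sum>i\<in>I. mset_set (U i)) v = (\<Sum>i\<in>I. of_bool (v \<in> U i))"
    using assms(3) by (simp add: count_sum of_bool_def count_mset_set' cong: sum.cong)
  also have "\<dots> = of_bool (v \<in> (\<Union>i\<in>I. U i))"
  proof (cases "v \<in> (\<Union>i\<in>I. U i)")
    case True
    then obtain k where k: "k \<in> I" "v \<in> U k"
      by blast
    have "v \<in> U i \<longleftrightarrow> i = k" if "i \<in> I" for i
      using k that assms(4)[of i v] assms(4)[of k v] inj_onD[OF assms(2), of i k] by auto
    then have "(\<Sum>i\<in>I. of_bool (v \<in> U i) :: nat) = (\<Sum>i\<in>I. if i = k then 1 else 0)"
      by (intro sum.cong) auto
    then show ?thesis
      using k True assms(1) by simp
  qed simp
  finally show "count (\<Sum>i\<in>I. mset_set (U i)) v = of_bool (v \<in> (\<Union>i\<in>I. U i))" .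
  have count: "count (\<Sum>i\<in>I. replicate_mset (card (U i)) (u i)) w =
      (\<Sum>i\<in>I. if w = u i then card (U i) else 0)"
    by (simp add: count_sum)
  show "count (\<Sum>i\<in>I. replicate_mset (card (U i)) (u i)) w = cnt (\<Union>i\<in>I. U i) w"
  proof (cases "w \<in> u ` I")
    case True
    then obtain k where k: "k \<in> I" "w = u k"
      by blast
    have "(\<Sum>i\<in>I. if w = u i then card (U i) else 0) = (\<Sum>i\<in>I. if i = k then card (U i) else 0)"
      using k assms(2) by (intro sum.cong) (auto dest: inj_onD)
    moreover have "{i. (w, i) \<in> (\<Union>i\<in>I. U i)} = snd ` U k"
    proof (intro subset_antisym subsetI)
      fix i assume "i \<in> {i. (w, i) \<in> (\<Union>i\<in>I. U i)}"
      then obtain l where l: "l \<in> I" "(w, i) \<in> U l"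
        by blast
      then have "l = k"
        using k assms(2,4) by (fastforce dest: inj_onD)
      then show "i \<in> snd ` U k"
        using l by force
    next
      fix i assume "i \<in> snd ` U k"
      then obtain v where "v \<in> U k" "i = snd v"
        by blast
      then show "i \<in> {i. (w, i) \<in> (\<Union>i\<in>I. U i)}"
        using k assms(4)[OF k(1)] by (auto intro!: bexI[of _ k]) (metis prod.collapse)
    qed
    moreover have "inj_on snd (U k)"
      using assms(4)[OF k(1)] by (auto simp: inj_on_def prod_eq_iff)
    ultimately show ?thesis
      using count k assms(1) by (simp add: cnt_def card_image)
  next
    case False
    then have "{i. (w, i) \<in> (\<Union>i\<in>I. U i)} = {}"
      using assms(4) by fastforce
    then show ?thesis
      using count False by (auto simp: cnt_def intro!: sum.neutral)
  qed
qed

section \<open>Construction of the detachment\<close>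

text \<open>The bound \<open>g u \<ge> 1\<close> is forced by the conclusion, as an amalgamation
  function is onto and its fibers are nonempty. Pairs serve as new vertices, so that
  \<open>fst\<close> can be the amalgamation function.\<close>

theorem theorem4p1:
  fixes F :: "('v, 'e, 'h) hgraph" and k :: nat and f :: "'e \<Rightarrow> nat" and g :: "'v \<Rightarrow> nat"
  assumes "hypergraph F"
    and "edge_coloring k F f"
    and "\<forall>u\<in>verts F. g u \<ge> 1"
    and "simple_fun F g"
  shows "\<exists>(G :: ('v \<times> nat, 'e, 'h) hgraph) (\<Psi> :: 'v \<times> nat \<Rightarrow> 'v).
    detachment G F \<Psi> g \<and> simple_hypergraph G \<and>
    (\<forall>u\<in>verts F. \<forall>v\<in>fiber G \<Psi> u.
       real (degree G v) \<approx> real (degree F u) / real (g u)) \<and>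
    (\<forall>u\<in>verts F. \<forall>v\<in>fiber G \<Psi> u. \<forall>j\<in>{1..k}.
       real (degree (color_class G f j) v) \<approx> real (degree (color_class F f j) u) / real (g u)) \<and>
    (\<forall>(r :: nat) (u :: nat \<Rightarrow> 'v) (m :: nat \<Rightarrow> nat) (U :: nat \<Rightarrow> ('v \<times> nat) set).
       inj_on u {1..r} \<and>
       (\<forall>i\<in>{1..r}. u i \<in> verts F \<and> U i \<subseteq> fiber G \<Psi> (u i) \<and> card (U i) = m i \<and> m i \<le> g (u i)) \<longrightarrow>
       real (multiplicity G (\<Sum>i=1..r. mset_set (U i))) \<approx>
         real (multiplicity F (\<Sum>i=1..r. replicate_mset (m i) (u i))) /
           (\<Prod>i=1..r. real (g (u i) choose m i))) \<and>
    (\<forall>(r :: nat) (u :: nat \<Rightarrow> 'v) (m :: nat \<Rightarrow> nat) (U :: nat \<Rightarrow> ('v \<times> nat) set). \<forall>j\<in>{1..k}.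
       inj_on u {1..r} \<and>
       (\<forall>i\<in>{1..r}. u i \<in> verts F \<and> U i \<subseteq> fiber G \<Psi> (u i) \<and> card (U i) = m i \<and> m i \<le> g (u i)) \<longrightarrow>
       real (multiplicity (color_class G f j) (\<Sum>i=1..r. mset_set (U i))) \<approx>
         real (multiplicity (color_class F f j) (\<Sum>i=1..r. replicate_mset (m i) (u i))) /
           (\<Prod>i=1..r. real (g (u i) choose m i)))"
proof -
  define d where "d = (\<lambda>e u. card (hinges_between F u e))"
  \<comment> \<open>The value 0 outside \<open>verts F\<close> confines the slots to vertices of
    \<open>F\<close>, where \<open>g\<close> is meaningful.\<close>
  define r where "r = (\<lambda>u. if u \<in> verts F then g u else 0)"
  have fin: "finite (verts F)" "finite (edges F)" "finite (hinges F)"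
    and vert_F: "\<And>h. h \<in> hinges F \<Longrightarrow> vert_of F h \<in> verts F"
    and edge_F: "edge_of F ` hinges F = edges F"
    using assms(1) by (auto simp: hypergraph_def)
  have fin_hb: "finite (hinges_between F u e)" for u e
    using fin by (simp add: hinges_between_def)
  have d_out: "d e u = 0" if "u \<notin> verts F" for e u
  proof -
    have "hinges_between F u e = {}"
      using that vert_F by (auto simp: hinges_between_def)
    then show ?thesis
      by (simp add: d_def)
  qed
  have d_le: "\<forall>e\<in>edges F. \<forall>u. d e u \<le> r u"
    using assms(4) d_out by (auto simp: simple_fun_def d_def r_def)
  have r_out: "\<forall>u. u \<notin> verts F \<longrightarrow> r u = 0"
    by (simp add: r_def)
  \<comment> \<open>All edges start with the empty label, so the instance \<open>l = []\<close>
    covers every edge.\<close>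
  obtain T where T0: "\<forall>e\<in>edges F. T e \<subseteq> slots r \<and> cnt (T e) = d e"
    and deg0: "\<forall>J\<in>color_sets. \<forall>u i. i < r u \<longrightarrow>
      real (card {e \<in> edges F. f e \<in> J \<and> (u, i) \<in> T e}) \<approx>
        real (\<Sum>e | e \<in> edges F \<and> f e \<in> J. d e u) / real (r u)"
    and mult0: "\<forall>J\<in>color_sets. \<forall>l :: bool list. \<forall>W \<subseteq> slots r.
      real (card {e \<in> edges F. f e \<in> J \<and> [] = l \<and> T e = W}) \<approx>
        real (card {e \<in> edges F. f e \<in> J \<and> [] = l \<and> d e = cnt W}) /
          real (\<Prod>u\<in>verts F. r u choose cnt W u)"
    using balanced_split[where d = d and r = r and f = f and lab = "\<lambda>_. []", OF fin(2,1) d_le r_out] by blast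
  note T = conjunct1[OF bspec[OF T0]] conjunct2[OF bspec[OF T0]]
  \<comment> \<open>The hinges of \<open>e\<close> at \<open>u\<close> are as many as the slots over
    \<open>u\<close> in \<open>T e\<close>. A bijection between them moves each hinge to its own
    slot, so no slot meets an edge twice.\<close>
  have "\<exists>b. bij_betw b (hinges_between F u e) {i. (u, i) \<in> T e}" if "e \<in> edges F" for u e
    using T(2)[OF that] fin_hb finite_slots_section[OF T(1)[OF that]]
    by (intro finite_same_card_bij) (auto simp: cnt_def d_def fun_eq_iff)
  then obtain ix where ix: "\<And>e u. e \<in> edges F \<Longrightarrow> bij_betw (ix e u) (hinges_between F u e) {i. (u, i) \<in> T e}"
    by metis
  define G :: "('v \<times> nat, 'e, 'h) hgraph" where
    "G = \<lparr>verts = slots r, edges = edges F, hinges = hinges F,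
      vert_of = (\<lambda>h. (vert_of F h, ix (edge_of F h) (vert_of F h) h)), edge_of = edge_of F\<rparr>"
  have hb_G: "card (hinges_between G v e) = of_bool (v \<in> T e)" if e: "e \<in> edges F" for v e
  proof -
    obtain u i where v: "v = (u, i)"
      by (cases v)
    have eq: "hinges_between G v e = {h \<in> hinges_between F u e. ix e u h = i}"
      by (auto simp: G_def hinges_between_def v)
    show ?thesis
    proof (cases "v \<in> T e")
      case True
      then obtain h where h: "h \<in> hinges_between F u e" "ix e u h = i"
        using ix[OF e, of u] v by (force simp: bij_betw_def)
      then have "{h \<in> hinges_between F u e. ix e u h = i} = {h}"
        using ix[OF e, of u] by (auto simp: bij_betw_def inj_on_def)
      then show ?thesis
        using eq True by simp
    next
      case False
      then have "hinges_between G v e = {}"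
        using ix[OF e, of u] v eq by (auto simp: bij_betw_def)
      then show ?thesis
        using False by simp
    qed
  qed
  have vert_G: "vert_of G h \<in> slots r" if h: "h \<in> hinges F" for h
  proof -
    have e: "edge_of F h \<in> edges F"
      using h edge_F by blast
    have "h \<in> hinges_between F (vert_of F h) (edge_of F h)"
      using h by (simp add: hinges_between_def)
    then have "vert_of G h \<in> T (edge_of F h)"
      using ix[OF e, of "vert_of F h"] by (auto simp: G_def bij_betw_def)
    then show ?thesis
      using T(1)[OF e] by blast
  qed
  have fib: "fiber G fst u = {u} \<times> {..<g u}" if "u \<in> verts F" for u
    using that by (auto simp: fiber_def G_def slots_def r_def)
  have slots_eq: "slots r = (SIGMA u:verts F. {..<g u})"
    by (auto simp: slots_def r_def split: if_splits)
  then have "finite (slots r)"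
    using fin by auto
  then have hyper_G: "hypergraph G"
    using fin edge_F vert_G by (auto simp: hypergraph_def G_def)
  \<comment> \<open>Surjectivity: every vertex has at least one slot because \<open>g\<close> is
    positive.\<close>
  have "fst ` slots r = verts F"
    using assms(3) by (auto simp: slots_eq fst_image_Sigma lessThan_empty_iff)
  then have "amalgamation F G fst"
    by (auto simp: amalgamation_def G_def)
  then have detach: "detachment G F fst g"
    using hyper_G by (auto simp: detachment_def fib)
  have edges_G: "edges G = edges F" and verts_G: "verts G = slots r"
    by (simp_all add: G_def)
  have simple: "simple_hypergraph G"
    by (simp add: simple_hypergraph_def simple_fun_def edges_G hb_G)
  have deg: "real (\<Sum>e | e \<in> edges F \<and> f e \<in> J. card (hinges_between G v e)) \<approx>
      real (\<Sum>e | e \<in> edges F \<and> f e \<in> J. card (hinges_between F u e)) / real (g u)"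
    if J: "J \<in> color_sets" and u: "u \<in> verts F" and v: "v \<in> fiber G fst u" for J u v
  proof -
    obtain i where i: "v = (u, i)" "i < r u"
      using v u by (auto simp: fib r_def)
    have "(\<Sum>e | e \<in> edges F \<and> f e \<in> J. card (hinges_between G v e)) =
        (\<Sum>e | e \<in> edges F \<and> f e \<in> J. of_bool (v \<in> T e))"
      by (intro sum.cong) (auto simp: hb_G)
    also have "\<dots> = card {e \<in> edges F. f e \<in> J \<and> v \<in> T e}"
      using fin by (simp add: of_bool_def sum.If_cases Int_def conj_assoc)
    finally show ?thesis
      using bspec[OF deg0 J, rule_format, OF i(2)] i u by (simp add: d_def r_def)
  qed
  have mult: "real (card {e \<in> edges F. f e \<in> J \<and>
        (\<forall>v\<in>slots r. card (hinges_between G v e) = count (\<Sum>i=1..n. mset_set (U i)) v)}) \<approx>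
      real (card {e \<in> edges F. f e \<in> J \<and>
        (\<forall>w\<in>verts F. card (hinges_between F w e) = count (\<Sum>i=1..n. replicate_mset (m i) (u i)) w)}) /
        (\<Prod>i=1..n. real (g (u i) choose m i))"
    if J: "J \<in> color_sets" and inj: "inj_on u {1..n}"
      and U: "\<forall>i\<in>{1..n}. u i \<in> verts F \<and> U i \<subseteq> fiber G fst (u i) \<and> card (U i) = m i \<and> m i \<le> g (u i)"
    for J u m U and n :: nat
  proof -
    define W where "W = (\<Union>i\<in>{1..n}. U i)"
    have finU: "finite (U i)" if "i \<in> {1..n}" for i
      using bspec[OF U that] by (auto simp: fib intro: finite_subset)
    have fstU: "fst v = u i" if "i \<in> {1..n}" "v \<in> U i" for i v
      using bspec[OF U that(1)] that(2) by (auto simp: fiber_def)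
    have W: "W \<subseteq> slots r"
      using U by (fastforce simp: W_def fiber_def verts_G)
    have countG: "count (\<Sum>i=1..n. mset_set (U i)) v = of_bool (v \<in> W)" for v
      unfolding W_def by (rule count_sum_mset_set[OF finite_atLeastAtMost inj]) (use finU fstU in auto)
    have "(\<Sum>i=1..n. replicate_mset (m i) (u i)) = (\<Sum>i=1..n. replicate_mset (card (U i)) (u i))"
      using U by (intro sum.cong) auto
    then have countF: "count (\<Sum>i=1..n. replicate_mset (m i) (u i)) w = cnt W w" for w
      unfolding W_def
    using count_sum_replicate_mset[where U = U, OF finite_atLeastAtMost inj] finU fstU by simp
    \<comment> \<open>As each edge meets a slot at most once, it lies on the multiset of the
      \<open>U i\<close> exactly if its set of slots is \<open>W\<close>.\<close>
    have "(\<forall>v\<in>slots r. card (hinges_between G v e) = of_bool (v \<in> W)) \<longleftrightarrow> T e = W"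
      if "e \<in> edges F" for e
      using T(1)[OF that] W hb_G[OF that] by auto
    then have eqG: "{e \<in> edges F. f e \<in> J \<and>
        (\<forall>v\<in>slots r. card (hinges_between G v e) = count (\<Sum>i=1..n. mset_set (U i)) v)} =
        {e \<in> edges F. f e \<in> J \<and> T e = W}"
      unfolding countG by blast
    have "(\<forall>w\<in>verts F. card (hinges_between F w e) = cnt W w) \<longleftrightarrow> d e = cnt W" for e
    proof -
      \<comment> \<open>Outside \<open>verts F\<close> both functions are 0, so agreement on the
        vertices of \<open>F\<close> is equality of functions.\<close>
      have "d e w = cnt W w" if "w \<notin> verts F" for w
        using cnt_le[OF W, of w] that d_out r_out by simp
      then show ?thesis
        unfolding fun_eq_iff d_def by blast
    qed
    then have eqF: "{e \<in> edges F. f e \<in> J \<and>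
        (\<forall>w\<in>verts F. card (hinges_between F w e) = count (\<Sum>i=1..n. replicate_mset (m i) (u i)) w)} =
        {e \<in> edges F. f e \<in> J \<and> d e = cnt W}"
      unfolding countF by blast
    have cnt_W: "cnt W (u i) = m i" if i: "i \<in> {1..n}" for i
    proof -
      have "cnt W (u i) = (\<Sum>l=1..n. if u i = u l then m l else 0)"
        unfolding countF[symmetric] by (simp add: count_sum)
      also have "\<dots> = (\<Sum>l=1..n. if l = i then m l else 0)"
        using inj i by (intro sum.cong) (auto dest: inj_onD)
      finally show ?thesis
        using i by simp
    qed
    \<comment> \<open>A vertex that is none of the \<open>u i\<close> has no slot in
      \<open>W\<close> and contributes the factor \<open>r w choose 0 = 1\<close>.\<close>
    have "(\<Prod>w\<in>verts F. r w choose cnt W w) = (\<Prod>w\<in>u ` {1..n}. r w choose cnt W w)"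
    proof (rule prod.mono_neutral_right)
      show "\<forall>w\<in>verts F - u ` {1..n}. (r w choose cnt W w) = 1"
      proof
        fix w assume "w \<in> verts F - u ` {1..n}"
        then have "{i. (w, i) \<in> W} = {}"
          using fstU by (fastforce simp: W_def)
        then show "(r w choose cnt W w) = 1"
          by (simp add: cnt_def)
      qed
    qed (use fin U in auto)
    also have "\<dots> = (\<Prod>i=1..n. r (u i) choose cnt W (u i))"
      using inj by (simp add: prod.reindex)
    also have "\<dots> = (\<Prod>i=1..n. g (u i) choose m i)"
      using U cnt_W by (intro prod.cong) (auto simp: r_def)
    finally have prod: "real (\<Prod>w\<in>verts F. r w choose cnt W w) = (\<Prod>i=1..n. real (g (u i) choose m i))"
      by simp
    show ?thesis
      using bspec[OF mult0 J, rule_format, OF W, of "[]"] unfolding eqG eqF prod by simp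
  qed
  \<comment> \<open>\<open>UNIV\<close> yields the estimates for the whole hypergraph,
    \<open>{j}\<close> those for the color class \<open>j\<close>.\<close>
  have all: "(UNIV :: nat set) \<in> color_sets" and col: "\<And>j :: nat. {j} \<in> color_sets"
    by auto
  show ?thesis
  proof (intro exI[of _ G] exI[of _ fst] conjI ballI allI impI)
    fix u v assume "u \<in> verts F" "v \<in> fiber G fst u"
    then show "real (degree G v) \<approx> real (degree F u) / real (g u)"
      using deg[OF all] by (simp add: degree_eq_sum hyper_G assms(1) edges_G)
  next
    fix u v j assume "u \<in> verts F" "v \<in> fiber G fst u"
    then show "real (degree (color_class G f j) v) \<approx> real (degree (color_class F f j) u) / real (g u)"
      using deg[OF col] by (simp add: degree_color_class_eq_sum hyper_G assms(1) edges_G)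
  next
    fix n :: nat and u m U
    assume A: "inj_on u {1..n} \<and> (\<forall>i\<in>{1..n}. u i \<in> verts F \<and> U i \<subseteq> fiber G fst (u i) \<and>
      card (U i) = m i \<and> m i \<le> g (u i))"
    show "real (multiplicity G (\<Sum>i=1..n. mset_set (U i))) \<approx>
        real (multiplicity F (\<Sum>i=1..n. replicate_mset (m i) (u i))) /
          (\<Prod>i=1..n. real (g (u i) choose m i))"
      using mult[OF all conjunct1[OF A] conjunct2[OF A]]
      by (simp only: multiplicity_def edges_on_def edges_G verts_G UNIV_I simp_thms)
  next
    fix n :: nat and u m U j
    assume A: "inj_on u {1..n} \<and> (\<forall>i\<in>{1..n}. u i \<in> verts F \<and> U i \<subseteq> fiber G fst (u i) \<and>
      card (U i) = m i \<and> m i \<le> g (u i))"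
    show "real (multiplicity (color_class G f j) (\<Sum>i=1..n. mset_set (U i))) \<approx>
        real (multiplicity (color_class F f j) (\<Sum>i=1..n. replicate_mset (m i) (u i))) /
          (\<Prod>i=1..n. real (g (u i) choose m i))"
      using mult[OF col conjunct1[OF A] conjunct2[OF A]]
      by (simp only: multiplicity_color_class edges_G verts_G singleton_iff simp_thms)
  qed (use detach simple in auto)
qed

end
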